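(* Let $K$ be a convex compactum and let $B\subset K$ be a boundary of $K$. Then $w(K)\le nw_{cz}(B)$.
   Context: All spaces are Tychonoff. A convex compactum is a compact convex subset of a (Hausdorff, real) locally convex linear space. $\mathcal A(K)$ denotes the set of continuous affine functions $f\colon K\to\mathbb R$. A set $B\subset K$ is a boundary of $K$ if for every $f\in\mathcal A(K)$ there is $b\in B$ with $f(b)=\max_{x\in K}f(x)$. $w(X)$ is the weight: the minimal cardinality of a base of $X$, plus $\omega$. A cozero set of $X$ is a set of the form $X\setminus f^{-1}(0)$ with $f\colon X\to\mathbb R$ continuous. A family $\mathcal N$ of subsets of $X$ is a $cz$-network if for every cozero set $U\subset X$ there is an at most countable $\mathcal M\subset\mathcal N$ with $\bigcup\mathcal M=U$. $nw_{cz}(X)$ is the minimal cardinality of a $cz$-network of $X$, plus $\omega$. *)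

theory Defs
  imports "HOL-Analysis.Analysis"
begin

unbundle cardinal_syntax

text \<open>
  Hausdorff real locally convex linear spaces. The library classes supply a Hausdorff topology
  with continuous addition and negation, but no class of topological vector spaces.
\<close>

class locally_convex_t2_space = real_vector + topological_ab_group_add + t2_space +
  assumes tendsto_scaleR_Pair:
    "LIM p (nhds c \<times>\<^sub>F nhds x). fst p *\<^sub>R snd p :> nhds (c *\<^sub>R x)"
  assumes locally_convex:
    "open U \<Longrightarrow> 0 \<in> U \<Longrightarrow>
      \<exists>V. open V \<and> 0 \<in> V \<and> V \<subseteq> U \<and>
        (\<forall>x\<in>V. \<forall>y\<in>V. \<forall>u\<ge>0. \<forall>v\<ge>0. u + v = 1 \<longrightarrow> u *\<^sub>R x + v *\<^sub>R y \<in> V)"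

lemma locally_convex_nhds_0:
  fixes U :: "'a::locally_convex_t2_space set"
  assumes "open U" "0 \<in> U"
  obtains V where "open V" "0 \<in> V" "V \<subseteq> U" "convex V"
  using locally_convex[OF assms] unfolding convex_def by blast

text \<open>
  The topological notions below are for an abstract topology; a subset \<open>S\<close> of a space carries
  the subspace topology \<open>top_of_set S\<close>.
\<close>

definition base_of_topology :: "'a topology \<Rightarrow> 'a set set \<Rightarrow> bool" where
  "base_of_topology X \<B> \<longleftrightarrow>
     (\<forall>V\<in>\<B>. openin X V) \<and> (\<forall>U. openin X U \<longrightarrow> (\<exists>\<M>\<subseteq>\<B>. \<Union>\<M> = U))"

definition cozero_set :: "'a topology \<Rightarrow> 'a set \<Rightarrow> bool" where
  "cozero_set X U \<longleftrightarrow>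
     (\<exists>f. continuous_map X euclideanreal f \<and> U = topspace X - {x \<in> topspace X. f x = 0})"

definition cz_network :: "'a topology \<Rightarrow> 'a set set \<Rightarrow> bool" where
  "cz_network X \<N> \<longleftrightarrow>
     (\<forall>N\<in>\<N>. N \<subseteq> topspace X) \<and>
     (\<forall>U. cozero_set X U \<longrightarrow> (\<exists>\<M>\<subseteq>\<N>. countable \<M> \<and> \<Union>\<M> = U))"

text \<open>
  Infinite cardinals are represented by cardinal orders, to be compared with \<open>\<le>o\<close>.
  \<open>min_card_plus_omega P\<close> is the least cardinality of a family satisfying \<open>P\<close>, plus \<open>\<omega>\<close>;
  it is meaningful only if some family satisfies \<open>P\<close>.
\<close>

definition min_card_plus_omega :: "('a set set \<Rightarrow> bool) \<Rightarrow> ('a set + nat) rel" where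
  "min_card_plus_omega P =
     |SOME \<N>. P \<N> \<and> (\<forall>\<N>'. P \<N>' \<longrightarrow> |\<N>| \<le>o |\<N>'| )| +c natLeq"

definition weight :: "'a topology \<Rightarrow> ('a set + nat) rel" where
  "weight X = min_card_plus_omega (base_of_topology X)"

definition nw_cz :: "'a topology \<Rightarrow> ('a set + nat) rel" where
  "nw_cz X = min_card_plus_omega (cz_network X)"

lemma min_card_plus_omega:
  assumes "P \<A>"
  obtains \<N> where "P \<N>" "\<And>\<N>'. P \<N>' \<Longrightarrow> |\<N>| \<le>o |\<N>'|"
    "min_card_plus_omega P = |\<N>| +c natLeq"
proof -
  have "\<exists>r\<in>card_of ` Collect P. \<forall>r'\<in>card_of ` Collect P. r \<le>o r'"
    by (rule exists_minim_Card_order) (use assms in \<open>auto simp: card_of_Card_order\<close>)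
  then have "\<exists>\<N>. P \<N> \<and> (\<forall>\<N>'. P \<N>' \<longrightarrow> |\<N>| \<le>o |\<N>'| )"
    by auto
  from someI_ex[OF this] show ?thesis
    using that unfolding min_card_plus_omega_def by blast
qed

lemma base_of_topology_openin: "base_of_topology X {U. openin X U}"
proof -
  have "\<exists>\<M>\<subseteq>{U. openin X U}. \<Union>\<M> = U" if "openin X U" for U
    by (rule exI[of _ "{U}"]) (simp add: that)
  then show ?thesis
    unfolding base_of_topology_def by simp
qed

lemma cz_network_Pow: "cz_network X (Pow (topspace X))"
proof -
  have "\<exists>\<M>\<subseteq>Pow (topspace X). countable \<M> \<and> \<Union>\<M> = U" if "cozero_set X U" for U
  proof -
    have "U \<subseteq> topspace X"
      using that unfolding cozero_set_def by blast
    then show ?thesis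
      by (intro exI[of _ "{U}"]) simp
  qed
  then show ?thesis
    unfolding cz_network_def by simp
qed

definition affine_on :: "'a::real_vector set \<Rightarrow> ('a \<Rightarrow> real) \<Rightarrow> bool" where
  "affine_on K f \<longleftrightarrow>
     (\<forall>x\<in>K. \<forall>y\<in>K. \<forall>t\<in>{0..1}. f ((1 - t) *\<^sub>R x + t *\<^sub>R y) = (1 - t) * f x + t * f y)"

text \<open>Elements of \<open>cont_affine K\<close> are functions on the whole type; only their values on \<open>K\<close> matter.\<close>

definition cont_affine :: "'a::{real_vector, topological_space} set \<Rightarrow> ('a \<Rightarrow> real) set" where
  "cont_affine K = {f. continuous_on K f \<and> affine_on K f}"

definition is_boundary ::
    "'a::{real_vector, topological_space} set \<Rightarrow> 'a set \<Rightarrow> bool" where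
  "is_boundary K B \<longleftrightarrow> B \<subseteq> K \<and> (\<forall>f\<in>cont_affine K. \<exists>b\<in>B. \<forall>x\<in>K. f x \<le> f b)"

end

(* Fix a cz-network N of B of cardinality kappa. For finitely many pairs (N_i, q_i) with N_i in the
   network and q_i rational, and for each rational accuracy and each bound, choose one continuous
   affine function that is uniformly bounded by that bound and close to q_i on N_i, if there is one;
   let D be the closure of these functions under midpoints, so that |D| <= kappa.
   Given a continuous affine f, countably many network elements on which f is nearly constant cover
   B. The functions in D that are close to f on the first n of them form a decreasing sequence of
   midpoint-convex sets of uniformly bounded functions, and at every point of B they are eventually
   close to f. By Simons' inequality for boundaries, some function in D is uniformly close to f on
   all of K. So D is dense in A(K), separates the points of K by Hahn-Banach, and hence
   generates the topology of the compact space K. *)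
theory Submission
  imports Defs
begin

section \<open>Cardinality of closures under a binary operation\<close>

lemma card_of_image_ordLeq: "|A| \<le>o r \<Longrightarrow> |f ` A| \<le>o r"
  using card_of_image ordLeq_transitive by blast

lemma Times_Cinfinite_bound: "Cinfinite r \<Longrightarrow> |A| \<le>o r \<Longrightarrow> |B| \<le>o r \<Longrightarrow> |A \<times> B| \<le>o r"
  by (auto simp: cinfinite_def card_of_Times_ordLeq_infinite_Field)

lemma countable_ordLeq_Cinfinite:
  assumes "Cinfinite r" "countable A"
  shows "|A| \<le>o r"
proof -
  obtain f :: "_ \<Rightarrow> nat" where "inj_on f A"
    using assms(2) by (rule countableE)
  then have "|A| \<le>o |UNIV :: nat set|"
    by (rule card_of_ordLeqI) simp
  then show ?thesis
    using card_of_nat natLeq_ordLeq_cinfinite[OF assms(1)] ordLeq_ordIso_trans ordLeq_transitive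
    by blast
qed

text \<open>One closure operator serves three binary operations: union of singletons produces finite
  sets of data, midpoints produce the dense family of affine functions, and intersection turns a
  subbase into a base.\<close>

inductive_set op_closure :: "('a \<Rightarrow> 'a \<Rightarrow> 'a) \<Rightarrow> 'a set \<Rightarrow> 'a set" for f A where
  base: "x \<in> A \<Longrightarrow> x \<in> op_closure f A"
| step: "x \<in> op_closure f A \<Longrightarrow> y \<in> op_closure f A \<Longrightarrow> f x y \<in> op_closure f A"

text \<open>The closure is exhausted by countably many stages, each adding the image of the square
  of the previous one. As \<open>r\<close> is infinite, neither squares nor countable unions lead
  above \<open>r\<close>.\<close>

lemma card_of_op_closure:
  assumes r: "Cinfinite r" and A: "|A| \<le>o r"
  shows "|op_closure f A| \<le>o r"
proof -
  have inf: "\<not> finite (Field r)" and co: "Card_order r"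
    using r by (auto simp: cinfinite_def)
  define D where "D = rec_nat A (\<lambda>_ E. E \<union> (\<lambda>(x, y). f x y) ` (E \<times> E))"
  have D0: "D 0 = A" and DS: "D (Suc n) = D n \<union> (\<lambda>(x, y). f x y) ` (D n \<times> D n)" for n
    by (simp_all add: D_def)
  have "|D n| \<le>o r" for n
  proof (induction n)
    case (Suc n)
    then have "|(\<lambda>(x, y). f x y) ` (D n \<times> D n)| \<le>o r"
      by (intro card_of_image_ordLeq Times_Cinfinite_bound[OF r])
    then show ?case
      unfolding DS by (rule Un_Cinfinite_bound[OF Suc.IH _ r])
  qed (simp add: D0 A)
  moreover have "|UNIV :: nat set| \<le>o r"
    by (rule countable_ordLeq_Cinfinite[OF r]) simp
  ultimately have "|\<Union>n. D n| \<le>o r"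
    by (intro card_of_UNION_ordLeq_infinite_Field[OF inf co]) auto
  moreover have "op_closure f A \<subseteq> (\<Union>n. D n)"
  proof
    have mono: "D m \<subseteq> D n" if "m \<le> n" for m n
      by (rule lift_Suc_mono_le[OF _ that]) (auto simp: DS)
    fix x assume "x \<in> op_closure f A"
    then show "x \<in> (\<Union>n. D n)"
    proof induction
      case (step x y)
      then obtain m n where "x \<in> D m" "y \<in> D n"
        by blast
      then have "x \<in> D (max m n)" "y \<in> D (max m n)"
        using mono[of m "max m n"] mono[of n "max m n"] by auto
      then have "f x y \<in> D (Suc (max m n))"
        unfolding DS by force
      then show ?case by blast
    qed (use D0 in blast)
  qed
  ultimately show ?thesis
    using card_of_mono1 ordLeq_transitive by blast
qed

text \<open>This makes \<open>card_of_op_closure\<close> a bound for the number of nonempty finite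
  subsets of \<open>P\<close>.\<close>

lemma finite_subset_in_op_closure_Un:
  assumes "finite F" "F \<noteq> {}" "F \<subseteq> P"
  shows "F \<in> op_closure (\<union>) ((\<lambda>x. {x}) ` P)"
  using assms
proof (induction F rule: finite_ne_induct)
  case (singleton x)
  then show ?case by (auto intro: op_closure.base)
next
  case (insert x F)
  then have "{x} \<union> F \<in> op_closure (\<union>) ((\<lambda>x. {x}) ` P)"
    by (intro op_closure.step) (auto intro: op_closure.base)
  then show ?case by simp
qed

lemma Inter_in_op_closure_Int:
  assumes "finite \<F>" "\<F> \<noteq> {}" "\<F> \<subseteq> \<A>"
  shows "\<Inter>\<F> \<in> op_closure (\<inter>) \<A>"
  using assms
proof (induction \<F> rule: finite_ne_induct)
  case (insert U \<F>)
  then show ?case by (auto intro: op_closure.intros)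
qed (auto intro: op_closure.base)

section \<open>Separating points by continuous linear functionals\<close>

definition sublinear :: "('a::real_vector \<Rightarrow> real) \<Rightarrow> bool" where
  "sublinear p \<longleftrightarrow> (\<forall>x y. p (x + y) \<le> p x + p y) \<and> (\<forall>c>0. \<forall>x. p (c *\<^sub>R x) = c * p x)"

lemma sublinear_add: "sublinear p \<Longrightarrow> p (x + y) \<le> p x + p y"
  and sublinear_scaleR: "sublinear p \<Longrightarrow> c > 0 \<Longrightarrow> p (c *\<^sub>R x) = c * p x"
  by (auto simp: sublinear_def)

lemma sublinear_0: "sublinear p \<Longrightarrow> p 0 = 0"
  using sublinear_scaleR[of p 2 0] by simp

lemma sublinear_neg_le: "sublinear p \<Longrightarrow> - p (- x) \<le> p x"
  using sublinear_add[of p x "- x"] sublinear_0[of p] by simp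

lemma sublinear_scaleR_nonneg: "sublinear p \<Longrightarrow> c \<ge> 0 \<Longrightarrow> p (c *\<^sub>R x) = c * p x"
  using sublinear_scaleR[of p c x] sublinear_0[of p] by (cases "c = 0") auto

text \<open>Common core of three constructions: the infimum over shifts, the infimum of a chain, and
  the gauge of a convex neighbourhood. An inequality under scaling suffices, because applying it to
  \<open>inverse c\<close> gives the reverse one.\<close>

lemma sublinear_Inf:
  fixes T :: "'a::real_vector \<Rightarrow> real set"
  assumes ne: "\<And>x. T x \<noteq> {}" and bdd: "\<And>x. bdd_below (T x)"
    and scale: "\<And>t c x. t \<in> T x \<Longrightarrow> c > 0 \<Longrightarrow> \<exists>s\<in>T (c *\<^sub>R x). s \<le> c * t"
    and add: "\<And>s t x y. s \<in> T x \<Longrightarrow> t \<in> T y \<Longrightarrow> \<exists>u\<in>T (x + y). u \<le> s + t"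
  shows "sublinear (\<lambda>x. Inf (T x))"
proof -
  have le: "Inf (T x) \<le> t" if "s \<in> T x" "s \<le> t" for s t x
    using cInf_lower[OF that(1) bdd] that(2) by simp
  have sc: "Inf (T (c *\<^sub>R x)) \<le> c * Inf (T x)" if "c > 0" for c x
  proof -
    have "Inf (T (c *\<^sub>R x)) / c \<le> Inf (T x)"
    proof (rule cInf_greatest[OF ne])
      fix t assume "t \<in> T x"
      from scale[OF this \<open>c > 0\<close>] le have "Inf (T (c *\<^sub>R x)) \<le> c * t" by blast
      then show "Inf (T (c *\<^sub>R x)) / c \<le> t"
        using \<open>c > 0\<close> by (simp add: field_simps)
    qed
    then show ?thesis using \<open>c > 0\<close> by (simp add: field_simps)
  qed
  have "Inf (T (c *\<^sub>R x)) = c * Inf (T x)" if "c > 0" for c x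
  proof (rule antisym[OF sc[OF that]])
    have "Inf (T (inverse c *\<^sub>R (c *\<^sub>R x))) \<le> inverse c * Inf (T (c *\<^sub>R x))"
      by (rule sc) (use that in simp)
    then show "c * Inf (T x) \<le> Inf (T (c *\<^sub>R x))"
      using that by (simp add: field_simps)
  qed
  moreover have "Inf (T (x + y)) \<le> Inf (T x) + Inf (T y)" for x y
  proof -
    have "Inf (T (x + y)) - t \<le> Inf (T x)" if "t \<in> T y" for t
    proof (rule cInf_greatest[OF ne])
      fix s assume "s \<in> T x"
      from add[OF this that] le have "Inf (T (x + y)) \<le> s + t" by blast
      then show "Inf (T (x + y)) - t \<le> s" by simp
    qed
    then have "Inf (T (x + y)) - Inf (T x) \<le> Inf (T y)"
      by (intro cInf_greatest[OF ne]) (simp add: algebra_simps)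
    then show ?thesis by simp
  qed
  ultimately show ?thesis
    unfolding sublinear_def by blast
qed

text \<open>A minimal sublinear functional is its own shift in every direction, hence odd, hence linear.\<close>

lemma sublinear_shift:
  assumes p: "sublinear p"
  obtains q where "sublinear q" "\<And>x. q x \<le> p x" "q (- v) \<le> - p v"
proof -
  \<comment> \<open>The shift of \<open>p\<close> along \<open>v\<close> is the infimum over
    \<open>t \<ge> 0\<close>. The value \<open>t = 0\<close> gives \<open>p\<close> itself, so the
    infimum lies below \<open>p\<close>; the value \<open>t = 1\<close> at \<open>- v\<close> gives
    \<open>p 0 - p v = - p v\<close>.\<close>
  define r where "r t x = p (x + t *\<^sub>R v) - t * p v" for t x
  have lower: "- p (- x) \<le> r t x" if "t \<ge> 0" for t x
    using sublinear_add[OF p, of "x + t *\<^sub>R v" "- x"] sublinear_scaleR_nonneg[OF p that, of v]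
    by (simp add: r_def)
  have bdd: "bdd_below ((\<lambda>t. r t x) ` {0..})" for x
    by (rule bdd_belowI2[of _ "- p (- x)"]) (use lower in auto)
  have "sublinear (\<lambda>x. INF t\<in>{0..}. r t x)"
  proof (rule sublinear_Inf[OF _ bdd])
    fix a c :: real and x assume a: "a \<in> (\<lambda>t. r t x) ` {0..}" and "c > 0"
    then obtain t where "t \<ge> 0" "a = r t x" by auto
    moreover have "r (c * t) (c *\<^sub>R x) = c * r t x"
      using sublinear_scaleR[OF p \<open>c > 0\<close>, of "x + t *\<^sub>R v"]
      by (simp add: r_def algebra_simps)
    ultimately show "\<exists>s\<in>(\<lambda>t. r t (c *\<^sub>R x)) ` {0..}. s \<le> c * a"
      using \<open>c > 0\<close> by (intro bexI[OF _ imageI[of "c * t"]]) auto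
  next
    fix a b :: real and x y assume "a \<in> (\<lambda>t. r t x) ` {0..}" "b \<in> (\<lambda>t. r t y) ` {0..}"
    then obtain t u where "t \<ge> 0" "a = r t x" "u \<ge> 0" "b = r u y" by auto
    moreover have "r (t + u) (x + y) \<le> r t x + r u y"
      using sublinear_add[OF p, of "x + t *\<^sub>R v" "y + u *\<^sub>R v"]
      by (simp add: r_def algebra_simps)
    ultimately show "\<exists>w\<in>(\<lambda>t. r t (x + y)) ` {0..}. w \<le> a + b"
      by (intro bexI[of _ "r (t + u) (x + y)"]) auto
  qed simp
  moreover have "(INF t\<in>{0..}. r t x) \<le> p x" for x
    using cINF_lower[OF bdd, of 0 x] by (simp add: r_def)
  moreover have "(INF t\<in>{0..}. r t (- v)) \<le> - p v"
    using cINF_lower[OF bdd, of 1 "- v"] by (simp add: r_def sublinear_0[OF p])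
  ultimately show ?thesis by (rule that)
qed

text \<open>Zorn's lemma for the pointwise order. The infimum of a chain is finite, since every
  sublinear functional below \<open>p\<close> is bounded below at \<open>x\<close> by
  \<open>- p (- x)\<close>.\<close>

lemma minimal_sublinear:
  assumes p: "sublinear p"
  obtains q where "sublinear q" "\<And>x. q x \<le> p x"
    "\<And>r. sublinear r \<Longrightarrow> (\<And>x. r x \<le> q x) \<Longrightarrow> r = q"
proof -
  define A where "A = {q. sublinear q \<and> q \<le> p}"
  have lower: "- p (- x) \<le> q x" if "q \<in> A" for q x
  proof -
    have "sublinear q" "q (- x) \<le> p (- x)" using that by (auto simp: A_def le_fun_def)
    then show ?thesis using sublinear_neg_le[of q x] by linarith
  qed
  \<comment> \<open>The order is reversed, so the maximal element given by Zorn's lemma is a minimal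
    functional.\<close>
  have "\<exists>m\<in>A. \<forall>a\<in>A. (\<lambda>x y. y \<le> x) m a \<longrightarrow> a = m"
  proof (rule predicate_Zorn)
    show "partial_order_on A (relation_of (\<lambda>x y. y \<le> x) A)"
      by (rule partial_order_on_relation_ofI) auto
    fix C assume "C \<in> Chains (relation_of (\<lambda>x y. y \<le> x) A)"
    then have CA: "C \<subseteq> A" and ch: "\<And>f g. f \<in> C \<Longrightarrow> g \<in> C \<Longrightarrow> f \<le> g \<or> g \<le> f"
      by (auto simp: Chains_def relation_of_def)
    show "\<exists>u\<in>A. \<forall>a\<in>C. u \<le> a"
    proof (cases "C = {}")
      case True
      then show ?thesis using p by (auto simp: A_def)
    next
      case False
      have bdd: "bdd_below ((\<lambda>f. f x) ` C)" for x
        by (rule bdd_belowI2[of _ "- p (- x)"]) (use CA lower in auto)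
      have "sublinear (\<lambda>x. INF f\<in>C. f x)"
      proof (rule sublinear_Inf[OF _ bdd])
        fix a c :: real and x assume "a \<in> (\<lambda>f. f x) ` C" and "c > 0"
        then obtain f where "f \<in> C" "a = f x" by blast
        then show "\<exists>s\<in>(\<lambda>f. f (c *\<^sub>R x)) ` C. s \<le> c * a"
          using CA sublinear_scaleR[of f c x] \<open>c > 0\<close>
          by (intro bexI[of _ "f (c *\<^sub>R x)"]) (auto simp: A_def)
      next
        fix a b :: real and x y assume "a \<in> (\<lambda>f. f x) ` C" "b \<in> (\<lambda>f. f y) ` C"
        then obtain f g where fg: "f \<in> C" "g \<in> C" and ab: "a = f x" "b = g y" by blast
        have *: "f (x + y) \<le> f x + f y" "g (x + y) \<le> g x + g y"
          using fg CA sublinear_add by (auto simp: A_def)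
        \<comment> \<open>The smaller of the two chain members is subadditive and lies below both,
          so it serves as the witness for the sum.\<close>
        from ch[OF fg] have "f (x + y) \<le> a + b \<or> g (x + y) \<le> a + b"
          using * unfolding ab le_fun_def by (metis add_left_mono add_right_mono order_trans)
        then show "\<exists>u\<in>(\<lambda>f. f (x + y)) ` C. u \<le> a + b"
          using fg by auto
      qed (use False in simp)
      moreover have le: "(\<lambda>x. INF f\<in>C. f x) \<le> g" if "g \<in> C" for g
        using cINF_lower[OF bdd that] by (simp add: le_fun_def)
      moreover obtain g where "g \<in> C" using False by blast
      moreover from this have "g \<le> p" using CA by (auto simp: A_def)
      ultimately have "(\<lambda>x. INF f\<in>C. f x) \<in> A"
        unfolding A_def using order_trans by blast
      then show ?thesis using le by blast
    qed
  qed
  then obtain q where q: "sublinear q" "q \<le> p" and min: "\<forall>r\<in>A. r \<le> q \<longrightarrow> r = q"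
    by (auto simp: A_def)
  show ?thesis
  proof (rule that[OF q(1)])
    show "q x \<le> p x" for x using q(2) by (simp add: le_fun_def)
    show "r = q" if "sublinear r" "\<And>x. r x \<le> q x" for r
    proof -
      have "r \<le> q" using that(2) by (simp add: le_fun_def)
      moreover from this have "r \<in> A" using that(1) q(2) by (auto simp: A_def)
      ultimately show ?thesis using min by blast
    qed
  qed
qed

text \<open>Take a minimal sublinear functional \<open>f\<close> below the shift of \<open>p\<close>
  along \<open>v\<close>. Minimality against its own shifts makes \<open>f\<close> odd, and an odd
  sublinear functional is linear. The first shift gives \<open>f (- v) \<le> - p v\<close>, which
  forces equality at \<open>v\<close>.\<close>

lemma hahn_banach_support:
  assumes p: "sublinear p"
  obtains f where "linear f" "\<And>x. f x \<le> p x" "f v = p v"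
proof -
  obtain p' where p': "sublinear p'" "\<And>x. p' x \<le> p x" "p' (- v) \<le> - p v"
    using sublinear_shift[OF p] by metis
  obtain f where f: "sublinear f" "\<And>x. f x \<le> p' x"
    and min: "\<And>r. sublinear r \<Longrightarrow> (\<And>x. r x \<le> f x) \<Longrightarrow> r = f"
    using minimal_sublinear[OF p'(1)] by metis
  have neg: "f (- x) = - f x" for x
  proof -
    obtain r where "sublinear r" "\<And>y. r y \<le> f y" "r (- x) \<le> - f x"
      using sublinear_shift[OF f(1)] by metis
    with min have "f (- x) \<le> - f x" by metis
    then show ?thesis
      using sublinear_neg_le[OF f(1), of x] by simp
  qed
  have "linear f"
  proof (rule linearI)
    fix x y
    show "f (x + y) = f x + f y"
      using sublinear_add[OF f(1), of x y] sublinear_add[OF f(1), of "- x" "- y"] neg[of "x + y"]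
      by (simp add: neg)
  next
    fix c x
    show "f (c *\<^sub>R x) = c *\<^sub>R f x"
      using sublinear_scaleR_nonneg[OF f(1), of c x] sublinear_scaleR_nonneg[OF f(1), of "- c" x]
        neg[of "c *\<^sub>R x"]
      by (cases "c \<ge> 0") auto
  qed
  moreover have le: "f x \<le> p x" for x
    using f(2) p'(2) order_trans by blast
  moreover have "f v = p v"
    using f(2)[of "- v"] p'(3) neg[of v] le[of v] by simp
  ultimately show ?thesis by (rule that)
qed

section \<open>Gauges and separation in locally convex spaces\<close>

lemma tendsto_scaleR_locally_convex:
  fixes x :: "'a::locally_convex_t2_space"
  assumes "(f \<longlongrightarrow> c) F" "(g \<longlongrightarrow> x) F"
  shows "((\<lambda>z. f z *\<^sub>R g z) \<longlongrightarrow> c *\<^sub>R x) F"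
  using filterlim_compose[OF tendsto_scaleR_Pair filterlim_Pair[OF assms]]
  by simp

text \<open>A convex neighbourhood \<open>U\<close> of 0 that misses \<open>v = x - y\<close> has a
  sublinear gauge with value at least 1 at \<open>v\<close>. A linear functional that supports the
  gauge at \<open>v\<close> is positive there, and it is at most 1 on \<open>U\<close>, which makes
  it continuous.\<close>

lemma separating_functional:
  fixes x y :: "'a::locally_convex_t2_space"
  assumes "x \<noteq> y"
  obtains f :: "'a \<Rightarrow> real" where "linear f" "continuous_on UNIV f" "f y < f x"
proof -
  define v where "v = x - y"
  have "v \<noteq> 0" using assms by (simp add: v_def)
  obtain W where "open W" "0 \<in> W" "v \<notin> W"
    using t1_space[of 0 v] \<open>v \<noteq> 0\<close> by metis
  then obtain U where U: "open U" "0 \<in> U" "v \<notin> U" "convex U"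
    using locally_convex_nhds_0[of W] by (metis subsetD)
  define T where "T z = {t. t > 0 \<and> (1 / t) *\<^sub>R z \<in> U}" for z
  \<comment> \<open>the gauge of \<open>U\<close>\<close>
  define p where "p z = Inf (T z)" for z
  \<comment> \<open>Continuity of scalar multiplication at 0 makes \<open>U\<close> absorbing, so
    the gauge is an infimum over a nonempty set.\<close>
  have absorb: "T z \<noteq> {}" for z
  proof -
    have "((\<lambda>t. t *\<^sub>R z) \<longlongrightarrow> 0 *\<^sub>R z) (at_right (0::real))"
      by (intro tendsto_scaleR_locally_convex tendsto_intros)
    then have "eventually (\<lambda>t. t *\<^sub>R z \<in> U) (at_right (0::real))"
      using U(1,2) by (simp add: topological_tendstoD)
    then have "eventually (\<lambda>t. t *\<^sub>R z \<in> U \<and> t > 0) (at_right (0::real))"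
      using eventually_at_right_less by (rule eventually_conj)
    then obtain t where "t > 0" "t *\<^sub>R z \<in> U"
      using eventually_happens'[OF trivial_limit_at_right_real] by blast
    then show ?thesis by (auto simp: T_def intro!: exI[of _ "1 / t"])
  qed
  have bdd: "bdd_below (T z)" for z
    by (rule bdd_belowI[of _ 0]) (auto simp: T_def)
  have mem: "p z \<le> t" if "t \<in> T z" for t z
    unfolding p_def by (rule cInf_lower[OF that bdd])
  have up: "t \<in> T z" if "s \<in> T z" "s \<le> t" for s t z
  proof -
    have "s > 0" "(1 / s) *\<^sub>R z \<in> U" using that by (auto simp: T_def)
    then have "(s / t) *\<^sub>R ((1 / s) *\<^sub>R z) + (1 - s / t) *\<^sub>R 0 \<in> U"
      using that U(2) by (intro convexD[OF U(4)]) auto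
    then show ?thesis using \<open>s > 0\<close> that by (auto simp: T_def)
  qed
  have scale: "c * t \<in> T (c *\<^sub>R z)" if "t \<in> T z" "c > 0" for t c z
    using that by (auto simp: T_def)
  have add: "s + t \<in> T (x + y)" if "s \<in> T x" "t \<in> T y" for s t x y
  proof -
    have *: "s > 0" "t > 0" "(1 / s) *\<^sub>R x \<in> U" "(1 / t) *\<^sub>R y \<in> U"
      using that by (auto simp: T_def)
    then have "(s / (s + t)) *\<^sub>R ((1 / s) *\<^sub>R x) + (t / (s + t)) *\<^sub>R ((1 / t) *\<^sub>R y) \<in> U"
      by (intro convexD[OF U(4)]) (auto simp: add_divide_distrib[symmetric])
    then show ?thesis using * by (auto simp: T_def scaleR_add_right)
  qed
  have "sublinear p"
    unfolding p_def by (rule sublinear_Inf[OF absorb bdd]) (use scale add in blast)+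
  obtain f where f: "linear f" "\<And>z. f z \<le> p z" "f v = p v"
    using hahn_banach_support[OF \<open>sublinear p\<close>] by metis
  have "p v \<ge> 1"
    unfolding p_def
  proof (rule cInf_greatest[OF absorb])
    fix t assume t: "t \<in> T v"
    show "1 \<le> t"
    proof (rule ccontr)
      assume "\<not> 1 \<le> t"
      with up[OF t, of 1] U(3) show False by (auto simp: T_def)
    qed
  qed
  then have "f y < f x"
    using f(3) linear_diff[OF f(1), of x y] by (simp add: v_def)
  moreover have le1: "f z \<le> 1" if "z \<in> U" for z
    using f(2)[of z] mem[of 1 z] that by (simp add: T_def)
  have "continuous_on UNIV f"
    unfolding continuous_on_def
  proof (intro ballI, rule tendstoI)
    fix z :: 'a and d :: real assume "d > 0"
    \<comment> \<open>The bound \<open>f \<le> 1\<close> on \<open>U\<close>, applied to both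
      differences scaled by \<open>1 / e\<close>, yields only a weak inequality with
      \<open>e\<close>; halving \<open>d\<close> makes it strict.\<close>
    define e where "e = d / 2"
    have "e > 0" "d = 2 * e" using \<open>d > 0\<close> by (auto simp: e_def)
    have "((\<lambda>w. (1 / e) *\<^sub>R (w - z)) \<longlongrightarrow> (1 / e) *\<^sub>R (z - z)) (at z)"
      "((\<lambda>w. (1 / e) *\<^sub>R (z - w)) \<longlongrightarrow> (1 / e) *\<^sub>R (z - z)) (at z)"
      by (intro tendsto_scaleR_locally_convex tendsto_intros)+
    then have "eventually (\<lambda>w. (1 / e) *\<^sub>R (w - z) \<in> U) (at z)"
      "eventually (\<lambda>w. (1 / e) *\<^sub>R (z - w) \<in> U) (at z)"
      using U(1,2) by (auto dest: topological_tendstoD)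
    then have "eventually (\<lambda>w. dist (f w) (f z) \<le> e) (at z)"
    proof eventually_elim
      case (elim w)
      then show ?case
        using le1[of "(1 / e) *\<^sub>R (w - z)"] le1[of "(1 / e) *\<^sub>R (z - w)"] \<open>e > 0\<close>
        by (simp add: linear_cmul[OF f(1)] linear_diff[OF f(1)] dist_real_def field_simps abs_le_iff)
    qed
    then show "eventually (\<lambda>w. dist (f w) (f z) < d) (at z)"
      by eventually_elim (use \<open>e > 0\<close> \<open>d = 2 * e\<close> in auto)
  qed
  ultimately show ?thesis using that f(1) by blast
qed

section \<open>Simons' inequality\<close>

text \<open>Choose \<open>g n\<close> greedily in \<open>C n\<close> so that the supremum of the
  partial sum plus the remaining weight is almost minimal. Midpoint convexity then keeps the
  rescaled tails of the series at its maximum point \<open>b\<close> almost as large as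
  \<open>m\<close>. If all functions of some \<open>C n\<close> were small at \<open>b\<close>, that
  tail would be small too.\<close>

lemma simons_inequality:
  fixes C :: "nat \<Rightarrow> ('x \<Rightarrow> real) set" and X B :: "'x set"
  assumes ne: "\<And>n. C n \<noteq> {}" and decr: "\<And>n. C (Suc n) \<subseteq> C n"
    and mid: "\<And>n f g. f \<in> C n \<Longrightarrow> g \<in> C n \<Longrightarrow> (\<lambda>x. (f x + g x) / 2) \<in> C n"
    and bdd: "\<And>f x. f \<in> C 0 \<Longrightarrow> x \<in> X \<Longrightarrow> \<bar>f x\<bar> \<le> M"
    and BX: "B \<subseteq> X"
    and attain: "\<And>g. (\<And>n. g n \<in> C n) \<Longrightarrow>
      \<exists>b\<in>B. \<forall>x\<in>X. (\<Sum>n. g n x / 2 ^ Suc n) \<le> (\<Sum>n. g n b / 2 ^ Suc n)"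
    and low: "\<And>f. f \<in> C 0 \<Longrightarrow> \<exists>x\<in>X. m \<le> f x"
    and "e > 0"
  shows "\<exists>b\<in>B. \<forall>n. \<exists>f\<in>C n. m - e < f b"
proof -
  \<comment> \<open>Two parts are lost in comparing \<open>m\<close> with \<open>H b\<close>, four
    in \<open>grow\<close>, and the seventh makes the final contradiction strict.\<close>
  define d where "d = e / 7"
  have "d > 0" "e = 7 * d" using \<open>e > 0\<close> by (simp_all add: d_def)
  define S where "S f = (SUP x\<in>X. f x)" for f :: "'x \<Rightarrow> real"
  have C0: "C n \<subseteq> C 0" for n
    by (induction n) (use decr in auto)
  have Xne: "X \<noteq> {}" using low ne by blast
  have Mpos: "0 \<le> M" using ne[of 0] Xne bdd by (metis abs_ge_zero equals0I order_trans)
  have S_upper: "f x \<le> S f" if "x \<in> X" "\<And>x. x \<in> X \<Longrightarrow> f x \<le> c" for f x c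
    unfolding S_def using that by (intro cSUP_upper bdd_aboveI2)
  have S_least: "S f \<le> c" if "\<And>x. x \<in> X \<Longrightarrow> f x \<le> c" for f c
    unfolding S_def using Xne that by (rule cSUP_least)
  \<comment> \<open>The factor \<open>1 / 2 ^ n\<close> is the total weight of the terms from index
    \<open>n\<close> on, as if one function were used for all of them. The tolerances
    \<open>d / 4 ^ n\<close> remain summable after the later multiplication by
    \<open>2 ^ n\<close>.\<close>
  define near where "near n h g \<longleftrightarrow> g \<in> C n \<and>
      (\<forall>f\<in>C n. S (\<lambda>x. h x + g x / 2 ^ n) \<le> S (\<lambda>x. h x + f x / 2 ^ n) + d / 4 ^ n)" for n h g
  have ex_near: "\<exists>g. near n h g" if h: "\<And>x. x \<in> X \<Longrightarrow> \<bar>h x\<bar> \<le> c" for n h c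
  proof -
    let ?S = "\<lambda>g. S (\<lambda>x. h x + g x / 2 ^ n)"
    have hf: "\<bar>h x + f x / 2 ^ n\<bar> \<le> c + M / 2 ^ n" if "f \<in> C n" "x \<in> X" for f x
    proof -
      have "\<bar>f x\<bar> / 2 ^ n \<le> M / 2 ^ n"
        using bdd[of f x] C0 that by (intro divide_right_mono) auto
      then show ?thesis
        using h[OF that(2)] abs_triangle_ineq[of "h x" "f x / 2 ^ n"] by simp
    qed
    obtain x where "x \<in> X" using Xne by blast
    have "bdd_below (?S ` C n)"
    proof (rule bdd_belowI2)
      fix f assume "f \<in> C n"
      have upper: "h y + f y / 2 ^ n \<le> c + M / 2 ^ n" if "y \<in> X" for y
        using hf[OF \<open>f \<in> C n\<close> that] by linarith
      have "- (c + M / 2 ^ n) \<le> h x + f x / 2 ^ n"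
        using hf[OF \<open>f \<in> C n\<close> \<open>x \<in> X\<close>] by linarith
      also have "\<dots> \<le> ?S f"
        by (rule S_upper[OF \<open>x \<in> X\<close> upper])
      finally show "- (c + M / 2 ^ n) \<le> ?S f" .
    qed
    moreover have "(INF f\<in>C n. ?S f) < (INF f\<in>C n. ?S f) + d / 4 ^ n"
      using \<open>d > 0\<close> by simp
    ultimately obtain g where "g \<in> C n" "?S g < (INF f\<in>C n. ?S f) + d / 4 ^ n"
      using ne[of n] by (subst (asm) cINF_less_iff) auto
    moreover have "(INF f\<in>C n. ?S f) \<le> ?S f" if "f \<in> C n" for f
      by (rule cINF_lower) fact+
    ultimately have "near n h g"
      unfolding near_def by force
    then show ?thesis by blast
  qed
  \<comment> \<open>The recursion carries only the partial sums; each choice is recovered from the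
    partial sum before it.\<close>
  define h where "h = rec_nat (\<lambda>_. 0) (\<lambda>n h. \<lambda>x. h x + (SOME g. near n h g) x / 2 ^ Suc n)"
  define g where "g n = (SOME g. near n (h n) g)" for n
  have h0: "h 0 x = 0" and hS: "h (Suc n) x = h n x + g n x / 2 ^ Suc n" for n x
    by (simp_all add: h_def g_def)
  \<comment> \<open>Both claims go through one induction: boundedness of \<open>h n\<close> makes a
    near-minimiser exist, and its membership in \<open>C n\<close> bounds the next partial
    sum.\<close>
  have hb: "(\<forall>x\<in>X. \<bar>h n x\<bar> \<le> M * (1 - 1 / 2 ^ n)) \<and> near n (h n) (g n)" for n
  proof (induction n)
    case 0
    then show ?case
      unfolding g_def using someI_ex[OF ex_near[of "h 0" 0 0]] h0 by fastforce
  next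
    case (Suc n)
    have "\<bar>h (Suc n) x\<bar> \<le> M * (1 - 1 / 2 ^ Suc n)" if "x \<in> X" for x
    proof -
      have "g n \<in> C n" using Suc by (simp add: near_def)
      then have "\<bar>g n x\<bar> / 2 ^ Suc n \<le> M / 2 ^ Suc n"
        using bdd[of "g n" x] C0 that by (intro divide_right_mono) auto
      moreover have "\<bar>h n x\<bar> \<le> M * (1 - 1 / 2 ^ n)" using Suc that by blast
      moreover have "M * (1 - 1 / 2 ^ n) + M / 2 ^ Suc n = M * (1 - 1 / 2 ^ Suc n)"
        by (simp add: field_simps)
      ultimately show ?thesis
        using abs_triangle_ineq[of "h n x" "g n x / 2 ^ Suc n"] unfolding hS by simp
    qed
    then show ?case
      unfolding g_def using someI_ex[OF ex_near[of "h (Suc n)" _ "Suc n"]] by blast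
  qed
  have gC: "g n \<in> C n" for n using hb[of n] by (simp add: near_def)
  have gM: "\<bar>g n x\<bar> \<le> M" if "x \<in> X" for n x using gC C0 bdd that by blast
  have h_sum: "h n x = (\<Sum>k<n. g k x / 2 ^ Suc k)" for n x
    by (induction n) (simp_all add: h0 hS)
  define H where "H x = (\<Sum>n. g n x / 2 ^ Suc n)" for x
  have geo: "(\<lambda>n. c / 2 ^ Suc n) sums c" for c :: real
    using sums_mult[OF power_half_series, of c] by (simp add: power_divide)
  have summ: "summable (\<lambda>n. g n x / 2 ^ Suc n)" if "x \<in> X" for x
    by (rule summable_comparison_test'[where N = 0, OF sums_summable[OF geo[of M]]])
      (use gM[OF that] in \<open>auto simp: divide_right_mono\<close>)
  \<comment> \<open>Multiplied by \<open>2 ^ n\<close>, the tail is an average of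
    \<open>g n\<close>, \<open>g (n + 1)\<close>, ... with weights of total 1, so bounds on these
    functions pass to it.\<close>
  have tail: "H x - h n x = (\<Sum>k. g (k + n) x / 2 ^ Suc k) / 2 ^ n"
    and tail_summ: "summable (\<lambda>k. g (k + n) x / 2 ^ Suc k)" if "x \<in> X" for x n
  proof -
    show s: "summable (\<lambda>k. g (k + n) x / 2 ^ Suc k)"
      by (rule summable_comparison_test'[where N = 0, OF sums_summable[OF geo[of M]]])
        (use gM[OF that] in \<open>auto simp: divide_right_mono\<close>)
    have "H x - h n x = (\<Sum>k. g (k + n) x / 2 ^ Suc (k + n))"
      unfolding H_def h_sum using suminf_minus_initial_segment[OF summ[OF that], of n] by simp
    also have "\<dots> = (\<Sum>k. (g (k + n) x / 2 ^ Suc k) / 2 ^ n)"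
      by (simp add: power_add field_simps)
    finally show "H x - h n x = (\<Sum>k. g (k + n) x / 2 ^ Suc k) / 2 ^ n"
      using suminf_divide[OF s, of "2 ^ n"] by simp
  qed
  have tail_le: "H x - h n x \<le> c / 2 ^ n" if "x \<in> X" "\<And>k. g (k + n) x \<le> c" for x n c
  proof -
    have "(\<Sum>k. g (k + n) x / 2 ^ Suc k) \<le> (\<Sum>k. c / 2 ^ Suc k)"
      by (rule suminf_le[OF _ tail_summ[OF that(1)] sums_summable[OF geo]])
        (use that in \<open>auto simp: divide_right_mono\<close>)
    then show ?thesis
      unfolding tail[OF that(1)] using sums_unique[OF geo[of c]] by (simp add: divide_right_mono)
  qed
  have tail_ge: "- M / 2 ^ n \<le> H x - h n x" if "x \<in> X" for x n
  proof -
    have "(\<Sum>k. - M / 2 ^ Suc k) \<le> (\<Sum>k. g (k + n) x / 2 ^ Suc k)"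
    proof (rule suminf_le[OF _ sums_summable[OF geo] tail_summ[OF that]])
      show "- M / 2 ^ Suc k \<le> g (k + n) x / 2 ^ Suc k" for k
        using gM[OF that, of "k + n"] by (intro divide_right_mono) auto
    qed
    then show ?thesis
      unfolding tail[OF that] using sums_unique[OF geo[of "- M"]] by (simp add: divide_right_mono)
  qed
  define a where "a n = S (\<lambda>x. h n x + g n x / 2 ^ n)" for n
  have a_upper: "h n x + g n x / 2 ^ n \<le> a n" if "x \<in> X" for n x
    unfolding a_def
  proof (rule S_upper[OF that, of _ "M + M"])
    fix x assume x: "x \<in> X"
    have "M * (1 - 1 / 2 ^ n) \<le> M" using Mpos by (simp add: mult_left_le)
    moreover have "g n x / 2 ^ n \<le> M / 2 ^ n"
      using gM[OF x, of n] by (intro divide_right_mono) auto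
    moreover have "M / 2 ^ n \<le> M / 1"
      using Mpos by (intro divide_left_mono) auto
    moreover have "\<bar>h n x\<bar> \<le> M * (1 - 1 / 2 ^ n)" using hb[of n] x by blast
    ultimately show "h n x + g n x / 2 ^ n \<le> M + M"
      by linarith
  qed
  have a_step: "a n \<le> a (Suc n) + d / 4 ^ n" for n
  proof -
    \<comment> \<open>the midpoint of two consecutive choices competed at step \<open>n\<close>\<close>
    let ?f = "\<lambda>x. (g n x + g (Suc n) x) / 2"
    have "?f \<in> C n" using mid gC decr by blast
    then have "a n \<le> S (\<lambda>x. h n x + ?f x / 2 ^ n) + d / 4 ^ n"
      using hb[of n] by (auto simp: near_def a_def)
    also have "(\<lambda>x. h n x + ?f x / 2 ^ n) = (\<lambda>x. h (Suc n) x + g (Suc n) x / 2 ^ Suc n)"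
      by (simp add: fun_eq_iff hS field_simps)
    finally show ?thesis by (simp add: a_def)
  qed
  \<comment> \<open>The constant is that of the geometric series: the errors
    \<open>d / 4 ^ i\<close> for \<open>i\<close> from \<open>n\<close> to \<open>n + k - 1\<close>
    add up to the last term.\<close>
  have a_add: "a n \<le> a (n + k) + (4 / 3) * d * (1 / 4 ^ n - 1 / 4 ^ (n + k))" for n k
  proof (induction k)
    case (Suc k)
    have "(4 / 3) * d * (1 / 4 ^ n - 1 / 4 ^ (n + k)) + d / 4 ^ (n + k)
        = (4 / 3) * d * (1 / 4 ^ n - 1 / 4 ^ (n + Suc k))"
      by (simp add: field_simps)
    then show ?case using Suc a_step[of "n + k"] unfolding add_Suc_right by linarith
  qed simp
  obtain b where b: "b \<in> B" "\<And>x. x \<in> X \<Longrightarrow> H x \<le> H b"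
    unfolding H_def using attain[OF gC] by blast
  have bX: "b \<in> X" using b(1) BX by blast
  \<comment> \<open>Let \<open>k\<close> tend to infinity in \<open>a_add\<close>: the functions
    behind \<open>a (n + k)\<close> exceed \<open>H\<close> by at most
    \<open>2 * M / 2 ^ (n + k)\<close>, and \<open>H\<close> is maximal at \<open>b\<close>. The
    factor 4/3 is rounded up to 2.\<close>
  have a_le: "a n \<le> H b + 2 * d / 4 ^ n" for n
  proof -
    have "a n \<le> H b + (4 / 3) * d / 4 ^ n + 2 * M / 2 ^ (n + k)" for k
    proof -
      have "a (n + k) \<le> H b + 2 * M / 2 ^ (n + k)"
        unfolding a_def
      proof (rule S_least)
        fix x assume x: "x \<in> X"
        have "g (n + k) x / 2 ^ (n + k) \<le> M / 2 ^ (n + k)"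
          using gM[OF x, of "n + k"] by (intro divide_right_mono) auto
        then show "h (n + k) x + g (n + k) x / 2 ^ (n + k) \<le> H b + 2 * M / 2 ^ (n + k)"
          using tail_ge[OF x, of "n + k"] b(2)[OF x] by simp
      qed
      moreover have "(4 / 3) * d * (1 / 4 ^ n - 1 / 4 ^ (n + k)) \<le> (4 / 3) * d / 4 ^ n"
        using \<open>d > 0\<close> by (simp add: field_simps)
      ultimately show ?thesis using a_add[of n k] by linarith
    qed
    moreover have "(\<lambda>k. H b + (4 / 3) * d / 4 ^ n + 2 * M / 2 ^ (n + k)) \<longlonglongrightarrow> H b + (4 / 3) * d / 4 ^ n + 0"
    proof -
      have "(\<lambda>k. 2 * M / 2 ^ n * (1 / 2) ^ k) \<longlonglongrightarrow> 2 * M / 2 ^ n * 0"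
        by (intro tendsto_intros LIMSEQ_power_zero) simp
      then have "(\<lambda>k. 2 * M / 2 ^ (n + k)) \<longlonglongrightarrow> 0"
        by (simp add: power_add power_divide field_simps)
      then show ?thesis by (intro tendsto_intros)
    qed
    ultimately have "a n \<le> H b + (4 / 3) * d / 4 ^ n + 0"
      by (intro LIMSEQ_le_const) blast+
    moreover have "(4 / 3) * d / 4 ^ n \<le> 2 * d / 4 ^ n"
      using \<open>d > 0\<close> by (intro divide_right_mono) auto
    ultimately show ?thesis by simp
  qed
  \<comment> \<open>At \<open>b\<close> the bound \<open>a_le\<close> limits the increment
    \<open>g n b / 2 ^ Suc n\<close>. So the rescaled remainder
    \<open>2 ^ n * (H b - h n b)\<close>, which starts at \<open>H b\<close>, drops by at most
    \<open>2 * d / 2 ^ n\<close> in step \<open>n\<close>; the first \<open>n\<close> drops add up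
    to \<open>4 * d * (1 - 1 / 2 ^ n)\<close>.\<close>
  have grow: "H b - 4 * d * (1 - 1 / 2 ^ n) \<le> 2 ^ n * (H b - h n b)" for n
  proof (induction n)
    case (Suc n)
    have "h n b + 2 * (h (Suc n) b - h n b) \<le> H b + 2 * d / 4 ^ n"
      using a_upper[OF bX, of n] a_le[of n] by (simp add: hS)
    then have "H b - h n b - 2 * d / 4 ^ n \<le> 2 * (H b - h (Suc n) b)" by simp
    then have "2 ^ n * (H b - h n b - 2 * d / 4 ^ n) \<le> 2 ^ n * (2 * (H b - h (Suc n) b))"
      by (rule mult_left_mono) simp
    moreover have "(2 :: real) ^ n * (2 * d / 4 ^ n) = 2 * d / 2 ^ n"
      by (simp add: field_simps flip: power_mult_distrib)
    ultimately have "2 ^ n * (H b - h n b) - 2 * d / 2 ^ n \<le> 2 ^ Suc n * (H b - h (Suc n) b)"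
      by (simp add: right_diff_distrib)
    moreover have "4 * d * (1 - 1 / 2 ^ n) + 2 * d / 2 ^ n = 4 * d * (1 - 1 / 2 ^ Suc n)"
      by (simp add: field_simps)
    ultimately show ?case using Suc by linarith
  qed (simp add: h0)
  have "m \<le> H b + 2 * d"
  proof -
    obtain x where "x \<in> X" "m \<le> g 0 x" using low[OF gC[of 0]] by blast
    then show ?thesis using a_upper[of x 0] a_le[of 0] by (simp add: h0)
  qed
  have "\<exists>f\<in>C n. m - e < f b" for n
  proof (rule ccontr)
    \<comment> \<open>All choices from index \<open>n\<close> on lie in \<open>C n\<close>, so they
      would all be at most \<open>m - e\<close> at \<open>b\<close>, and hence so would their
      average, the rescaled tail.\<close>
    assume "\<not> ?thesis"
    moreover have "g (k + n) \<in> C n" for k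
      by (induction k arbitrary: n) (use gC decr in \<open>auto simp flip: add_Suc_right\<close>)
    ultimately have "g (k + n) b \<le> m - e" for k
      by (meson not_less)
    then have "2 ^ n * (H b - h n b) \<le> m - e"
      using tail_le[OF bX, of n "m - e"] by (simp add: field_simps)
    moreover have "4 * d * (1 - 1 / 2 ^ n) \<le> 4 * d * 1"
      using \<open>d > 0\<close> by (intro mult_left_mono) auto
    ultimately show False
      using grow[of n] \<open>m \<le> H b + 2 * d\<close> \<open>d > 0\<close> \<open>e = 7 * d\<close> by linarith
  qed
  then show ?thesis using b(1) by blast
qed

section \<open>Continuous affine functions and boundaries\<close>

lemma cont_affine_lincomb:
  assumes "f \<in> cont_affine K" "g \<in> cont_affine K"
  shows "(\<lambda>x. a * f x + b * g x) \<in> cont_affine K"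
proof -
  have "a * f ((1 - t) *\<^sub>R x + t *\<^sub>R y) + b * g ((1 - t) *\<^sub>R x + t *\<^sub>R y)
      = (1 - t) * (a * f x + b * g x) + t * (a * f y + b * g y)"
    if "x \<in> K" "y \<in> K" "t \<in> {0..1}" for x y t
  proof -
    have "f ((1 - t) *\<^sub>R x + t *\<^sub>R y) = (1 - t) * f x + t * f y"
      "g ((1 - t) *\<^sub>R x + t *\<^sub>R y) = (1 - t) * g x + t * g y"
      using assms that by (auto simp: cont_affine_def affine_on_def)
    then show ?thesis by (simp only:) (simp add: algebra_simps)
  qed
  moreover have "continuous_on K (\<lambda>x. a * f x + b * g x)"
    using assms by (auto simp: cont_affine_def intro!: continuous_intros)
  ultimately show ?thesis
    unfolding cont_affine_def affine_on_def by blast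
qed

text \<open>The M-test gives uniform convergence and hence continuity; the affine identity is summed
  term by term. This lets the boundary property act on the series in Simons' inequality.\<close>

lemma cont_affine_suminf:
  assumes "convex K" and u: "\<And>n. u n \<in> cont_affine K"
    and le: "\<And>n x. x \<in> K \<Longrightarrow> \<bar>u n x\<bar> \<le> c n" and c: "summable c"
  shows "(\<lambda>x. \<Sum>n. u n x) \<in> cont_affine K"
proof -
  have "uniform_limit K (\<lambda>n x. \<Sum>i<n. u i x) (\<lambda>x. \<Sum>n. u n x) sequentially"
    by (rule Weierstrass_m_test[OF _ c]) (simp add: le)
  moreover have "continuous_on K (\<lambda>x. \<Sum>i<n. u i x)" for n
    using u by (auto simp: cont_affine_def intro!: continuous_intros)
  ultimately have "continuous_on K (\<lambda>x. \<Sum>n. u n x)"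
    by (intro uniform_limit_theorem[where F = sequentially]) auto
  moreover have "affine_on K (\<lambda>x. \<Sum>n. u n x)"
    unfolding affine_on_def
  proof (intro ballI)
    fix x y and t :: real assume xy: "x \<in> K" "y \<in> K" and t: "t \<in> {0..1}"
    have s: "summable (\<lambda>n. u n z)" if "z \<in> K" for z
      by (rule summable_comparison_test'[OF c, of 0]) (simp add: le that)
    have "(\<Sum>n. u n ((1 - t) *\<^sub>R x + t *\<^sub>R y)) = (\<Sum>n. (1 - t) * u n x + t * u n y)"
      using u xy t by (simp add: cont_affine_def affine_on_def)
    also have "\<dots> = (1 - t) * (\<Sum>n. u n x) + t * (\<Sum>n. u n y)"
      using s[OF xy(1)] s[OF xy(2)] by (simp add: suminf_add[symmetric] suminf_mult summable_mult)
    finally show "(\<Sum>n. u n ((1 - t) *\<^sub>R x + t *\<^sub>R y)) = \<dots>" .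
  qed
  ultimately show ?thesis by (simp add: cont_affine_def)
qed

lemma linear_in_cont_affine:
  assumes "linear f" "continuous_on UNIV f"
  shows "f \<in> cont_affine K"
  using assms continuous_on_subset[OF assms(2) subset_UNIV, of K]
  by (simp add: cont_affine_def affine_on_def linear_add linear_cmul)

section \<open>Countable covers of the boundary by network elements\<close>

lemma cozero_set_superlevel:
  fixes f :: "'a::topological_space \<Rightarrow> real"
  assumes "continuous_on B f"
  shows "cozero_set (top_of_set B) {x \<in> B. c < f x}"
  unfolding cozero_set_def
  by (rule exI[of _ "\<lambda>x. max 0 (f x - c)"]) (use assms in \<open>auto intro!: continuous_intros\<close>)

text \<open>For each rational \<open>q\<close> the points of \<open>B\<close> where \<open>f\<close>
  is within \<open>e\<close> of \<open>q\<close> form a cozero set, a countable union of network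
  elements. There are countably many \<open>q\<close>, and by density some \<open>q\<close> is close
  to each value of \<open>f\<close>.\<close>

lemma countable_cover_of_small_oscillation:
  fixes f :: "'a::topological_space \<Rightarrow> real"
  assumes net: "cz_network (top_of_set B) \<N>" and f: "continuous_on B f" and "e > 0"
  obtains P where "P \<subseteq> \<N> \<times> UNIV" "countable P" "B \<subseteq> \<Union> (fst ` P)"
    "\<forall>(N, q)\<in>P. \<forall>x\<in>N. \<bar>f x - of_rat q\<bar> < e"
proof -
  \<comment> \<open>The condition is written with negated sides to make it a superlevel set of a
    continuous function.\<close>
  have "\<exists>\<M>\<subseteq>\<N>. countable \<M> \<and> \<Union>\<M> = {x \<in> B. - e < - \<bar>f x - of_rat q\<bar>}" for q
  proof -
    have "cozero_set (top_of_set B) {x \<in> B. - e < - \<bar>f x - of_rat q\<bar>}"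
      by (intro cozero_set_superlevel continuous_intros f)
    then show ?thesis
      using net unfolding cz_network_def by blast
  qed
  then obtain \<M> where \<M>: "\<And>q. \<M> q \<subseteq> \<N>" "\<And>q. countable (\<M> q)"
      "\<And>q. \<Union>(\<M> q) = {x \<in> B. - e < - \<bar>f x - of_rat q\<bar>}"
    by metis
  define P where "P = prod.swap ` (SIGMA q:UNIV. \<M> q)"
  show ?thesis
  proof (rule that)
    show "P \<subseteq> \<N> \<times> UNIV" using \<M>(1) unfolding P_def by auto blast
    show "countable P" unfolding P_def using \<M>(2) by (intro countable_image countable_SIGMA) auto
    show "\<forall>(N, q)\<in>P. \<forall>x\<in>N. \<bar>f x - of_rat q\<bar> < e"
    proof safe
      fix N q x assume "(N, q) \<in> P" "x \<in> N"
      then have "x \<in> \<Union>(\<M> q)" by (auto simp: P_def)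
      then show "\<bar>f x - of_rat q\<bar> < e" unfolding \<M>(3) by simp
    qed
    show "B \<subseteq> \<Union> (fst ` P)"
    proof
      fix x assume "x \<in> B"
      obtain q where "f x < of_rat q" "of_rat q < f x + e"
        using of_rat_dense[of "f x" "f x + e"] \<open>e > 0\<close> by auto
      then have "x \<in> \<Union>(\<M> q)" unfolding \<M>(3) using \<open>x \<in> B\<close> by auto
      then show "x \<in> \<Union> (fst ` P)" by (force simp: P_def)
    qed
  qed
qed

text \<open>Doubling the domain to \<open>K \<times> {1, -1}\<close> turns the one-sided inequality into a two-sided one.\<close>

lemma boundary_eventually_close_imp_close:
  fixes K B :: "'a::{real_vector, topological_space} set"
  assumes K: "compact K" "convex K" and bd: "is_boundary K B" and f: "f \<in> cont_affine K"
    and E: "\<And>n. E n \<noteq> {}" "\<And>n. E (Suc n) \<subseteq> E n" "E 0 \<subseteq> cont_affine K"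
    and mid: "\<And>n g h. g \<in> E n \<Longrightarrow> h \<in> E n \<Longrightarrow> (\<lambda>x. (g x + h x) / 2) \<in> E n"
    and bdd: "\<And>g x. g \<in> E 0 \<Longrightarrow> x \<in> K \<Longrightarrow> \<bar>g x\<bar> \<le> M"
    and close: "\<And>b. b \<in> B \<Longrightarrow> \<exists>n. \<forall>g\<in>E n. \<bar>g b - f b\<bar> \<le> d"
    and "d < e"
  shows "\<exists>g\<in>E 0. \<forall>x\<in>K. \<bar>g x - f x\<bar> < e"
proof (rule ccontr)
  assume far: "\<not> ?thesis"
  have BK: "B \<subseteq> K" using bd by (simp add: is_boundary_def)
  have f_cont: "continuous_on K f" using f by (simp add: cont_affine_def)
  obtain L where L: "\<bar>f x\<bar> \<le> L" if "x \<in> K" for x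
    using compact_imp_bounded[OF compact_continuous_image[OF f_cont K(1)]]
    by (auto simp: bounded_iff)
  define C where "C n = (\<lambda>g (x, s). s * (g x - f x)) ` E n" for n
  have E0: "E n \<subseteq> E 0" for n
    by (induction n) (use E(2) in auto)
  \<comment> \<open>Simons' inequality with \<open>m = e\<close> and tolerance \<open>e - d\<close>:
    the assumption \<open>far\<close> supplies the lower bound \<open>e\<close>, and the resulting
    point has, for every \<open>n\<close>, a function in \<open>E n\<close> more than
    \<open>d\<close> away from \<open>f\<close>, against \<open>close\<close>.\<close>
  have "\<exists>p\<in>B \<times> {1, - 1}. \<forall>n. \<exists>u\<in>C n. e - (e - d) < u p"
  proof (rule simons_inequality[of C "K \<times> {1, - 1}" "M + L" "B \<times> {1, - 1}" e "e - d"])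
    show "C n \<noteq> {}" for n using E(1) by (simp add: C_def)
    show "C (Suc n) \<subseteq> C n" for n using E(2) by (auto simp: C_def)
    show "(\<lambda>p. (u p + v p) / 2) \<in> C n" if uv: "u \<in> C n" "v \<in> C n" for n u v
    proof -
      obtain g h where gh: "g \<in> E n" "h \<in> E n"
        and "u = (\<lambda>(x, s). s * (g x - f x))" "v = (\<lambda>(x, s). s * (h x - f x))"
        using uv by (auto simp: C_def)
      then have "(\<lambda>p. (u p + v p) / 2) = (\<lambda>(x, s). s * ((g x + h x) / 2 - f x))"
        by (simp only: fun_eq_iff split_paired_All prod.case) (simp add: field_simps)
      then show ?thesis unfolding C_def using mid[OF gh] by (intro image_eqI) auto
    qed
    show "\<bar>u p\<bar> \<le> M + L" if "u \<in> C 0" "p \<in> K \<times> {1, - 1}" for u p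
    proof -
      obtain g x s where "g \<in> E 0" "x \<in> K" "s \<in> {1, - 1}" "u p = s * (g x - f x)"
        using \<open>u \<in> C 0\<close> \<open>p \<in> K \<times> {1, - 1}\<close> by (auto simp: C_def)
      then show ?thesis
        using bdd[of g x] L[of x] abs_triangle_ineq4[of "g x" "f x"] by auto
    qed
    show "B \<times> {1, - 1} \<subseteq> K \<times> {1, - 1 :: real}" using BK by auto
    show "\<exists>p\<in>K \<times> {1, - 1}. e \<le> u p" if u: "u \<in> C 0" for u
    proof -
      obtain g where g: "g \<in> E 0" "u = (\<lambda>(x, s). s * (g x - f x))"
        using u by (auto simp: C_def)
      then obtain x where x: "x \<in> K" "e \<le> \<bar>g x - f x\<bar>"
        using far by (meson not_less)
      show ?thesis
      proof (cases "0 \<le> g x - f x")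
        case True
        then show ?thesis using x g(2) by (intro bexI[of _ "(x, 1)"]) auto
      next
        case False
        then show ?thesis using x g(2) by (intro bexI[of _ "(x, - 1)"]) auto
      qed
    qed
    show "0 < e - d" using \<open>d < e\<close> by simp
  next
    fix u :: "nat \<Rightarrow> 'a \<times> real \<Rightarrow> real" assume u: "\<And>n. u n \<in> C n"
    then have "\<forall>n. \<exists>g. g \<in> E n \<and> u n = (\<lambda>(x, s). s * (g x - f x))"
      by (auto simp: C_def)
    then obtain G where G: "\<And>n. G n \<in> E n" "\<And>n. u n = (\<lambda>(x, s). s * (G n x - f x))"
      by metis
    have GE0: "G n \<in> E 0" for n using G(1) E0 by blast
    have geo: "summable (\<lambda>n. (M + L) / 2 ^ Suc n)"
      using summable_mult[OF sums_summable[OF power_half_series], of "M + L"]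
      by (simp add: power_divide)
    have bound: "\<bar>(G n x - f x) / 2 ^ Suc n\<bar> \<le> (M + L) / 2 ^ Suc n" if "x \<in> K" for n x
    proof -
      have "\<bar>G n x - f x\<bar> \<le> M + L"
        using bdd[OF GE0 that, of n] L[OF that] abs_triangle_ineq4[of "G n x" "f x"] by linarith
      then show ?thesis by (simp add: divide_right_mono abs_divide)
    qed
    define H where "H x = (\<Sum>n. (G n x - f x) / 2 ^ Suc n)" for x
    have "H \<in> cont_affine K"
      unfolding H_def
    proof (rule cont_affine_suminf[OF K(2) _ bound geo])
      fix n
      have "G n \<in> cont_affine K" using GE0 E(3) by blast
      from cont_affine_lincomb[OF this f, of "1 / 2 ^ Suc n" "- 1 / 2 ^ Suc n"]
      show "(\<lambda>x. (G n x - f x) / 2 ^ Suc n) \<in> cont_affine K"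
        by (simp add: diff_divide_distrib)
    qed
    moreover from cont_affine_lincomb[OF this this, of "- 1" 0]
    have "(\<lambda>x. - H x) \<in> cont_affine K" by simp
    ultimately obtain b c where bc: "b \<in> B" "\<forall>x\<in>K. H x \<le> H b" "c \<in> B" "\<forall>x\<in>K. - H x \<le> - H c"
      using bd unfolding is_boundary_def by metis
    have sum_eq: "(\<Sum>n. u n (x, s) / 2 ^ Suc n) = s * H x" if "x \<in> K" for x s
    proof -
      have "summable (\<lambda>n. (G n x - f x) / 2 ^ Suc n)"
        by (rule summable_comparison_test'[OF geo, of 0]) (use bound[OF that] in simp)
      from suminf_mult[OF this, of s] show ?thesis
        by (simp add: G(2) H_def)
    qed
    \<comment> \<open>Both \<open>H\<close> and \<open>- H\<close> attain their maxima on
      \<open>B\<close>. The larger of the two is the maximum of the absolute value of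
      \<open>H\<close>, and the second coordinate records its sign.\<close>
    have "\<exists>p\<in>B \<times> {1, - 1}. \<forall>x\<in>K. H x \<le> snd p * H (fst p) \<and> - H x \<le> snd p * H (fst p)"
    proof (cases "- H c \<le> H b")
      case True
      then show ?thesis using bc by (intro bexI[of _ "(b, 1)"]) force+
    next
      case False
      then show ?thesis using bc by (intro bexI[of _ "(c, - 1)"]) force+
    qed
    then obtain p where p: "p \<in> B \<times> {1, - 1}"
      and max_p: "\<forall>x\<in>K. H x \<le> snd p * H (fst p) \<and> - H x \<le> snd p * H (fst p)"
      by blast
    obtain b' s' where "p = (b', s')" by fastforce
    with p max_p have b': "b' \<in> B" "s' \<in> {1, - 1}"
      and max: "\<And>x. x \<in> K \<Longrightarrow> H x \<le> s' * H b' \<and> - H x \<le> s' * H b'"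
      by auto
    have "(\<Sum>n. u n p / 2 ^ Suc n) \<le> (\<Sum>n. u n (b', s') / 2 ^ Suc n)"
      if p: "p \<in> K \<times> {1, - 1}" for p
    proof -
      obtain x s where xs: "p = (x, s)" "x \<in> K" "s \<in> {1, - 1}" using p by auto
      have "b' \<in> K" using b'(1) BK by blast
      show ?thesis unfolding xs(1) sum_eq[OF xs(2)] sum_eq[OF \<open>b' \<in> K\<close>]
        using max[OF xs(2)] xs(3) by auto
    qed
    then show "\<exists>b\<in>B \<times> {1, - 1}. \<forall>x\<in>K \<times> {1, - 1}.
        (\<Sum>n. u n x / 2 ^ Suc n) \<le> (\<Sum>n. u n b / 2 ^ Suc n)"
      using b' by blast
  qed
  then obtain b s where b: "b \<in> B" "s \<in> {1, - 1}" and "\<forall>n. \<exists>u\<in>C n. e - (e - d) < u (b, s)"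
    by blast
  then have big: "\<exists>g\<in>E n. d < s * (g b - f b)" for n
    by (auto simp: C_def)
  obtain n where n: "\<forall>g\<in>E n. \<bar>g b - f b\<bar> \<le> d" using close[OF b(1)] by blast
  obtain g where "g \<in> E n" "d < s * (g b - f b)" using big by blast
  moreover have "s * (g b - f b) \<le> \<bar>g b - f b\<bar>" using b(2) by auto
  ultimately show False using n by force
qed

text \<open>\<open>D\<close> is built before any \<open>f\<close> is given, so its size depends on
  the network alone; for each \<open>f\<close> the decreasing sets are then cut out of
  \<open>D\<close>.\<close>

lemma dense_affine_functions:
  fixes K B :: "'a::{real_vector, topological_space} set"
  assumes K: "compact K" "convex K" and bd: "is_boundary K B"
    and net: "cz_network (top_of_set B) \<N>" and r: "Cinfinite r" "|\<N>| \<le>o r"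
  shows "\<exists>D\<subseteq>cont_affine K. |D| \<le>o r \<and>
    (\<forall>f\<in>cont_affine K. \<forall>e>0. \<exists>g\<in>D. \<forall>x\<in>K. \<bar>g x - f x\<bar> < e)"
proof -
  define approx where "approx F k M g \<longleftrightarrow> (\<forall>x\<in>K. \<bar>g x\<bar> \<le> real M) \<and>
      (\<forall>(N, q)\<in>F. \<forall>x\<in>N. \<bar>g x - of_rat q\<bar> < inverse (real (Suc k)))"
    for F :: "('a set \<times> rat) set" and k M :: nat and g
  \<comment> \<open>\<open>pick\<close> may depend only on the finite data \<open>F\<close>, \<open>k\<close>, \<open>M\<close>: of these there are at most \<open>|\<N>| + \<omega>\<close>.\<close>
  define pick where "pick = (\<lambda>(F, k, M). SOME g. g \<in> cont_affine K \<and> approx F k M g)"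
  define \<F> where "\<F> = op_closure (\<union>) ((\<lambda>p. {p}) ` (\<N> \<times> (UNIV :: rat set)))"
  \<comment> \<open>Only solvable data are kept, so that every pick is a genuine approximant and not
    a default value of \<open>SOME\<close>.\<close>
  define Q where "Q = {(F, k, M) \<in> \<F> \<times> UNIV \<times> UNIV. \<exists>g. g \<in> cont_affine K \<and> approx F k M g}"
  define D where "D = op_closure (\<lambda>g h x. (g x + h x) / 2) (pick ` Q)"
  have "|\<F>| \<le>o r"
    unfolding \<F>_def by (intro card_of_op_closure[OF r(1)] card_of_image_ordLeq
        Times_Cinfinite_bound[OF r(1,2) countable_ordLeq_Cinfinite[OF r(1)]]) simp
  then have "|\<F> \<times> (UNIV :: nat set) \<times> (UNIV :: nat set)| \<le>o r"
    by (rule Times_Cinfinite_bound[OF r(1) _ countable_ordLeq_Cinfinite[OF r(1)]]) simp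
  moreover have "Q \<subseteq> \<F> \<times> UNIV \<times> UNIV" by (auto simp: Q_def)
  ultimately have "|Q| \<le>o r"
    using card_of_mono1 ordLeq_transitive by blast
  then have D_card: "|D| \<le>o r"
    unfolding D_def by (intro card_of_op_closure card_of_image_ordLeq r(1))
  have pick: "pick (F, k, M) \<in> cont_affine K \<and> approx F k M (pick (F, k, M))"
    if "(F, k, M) \<in> Q" for F k M
    unfolding pick_def prod.case
    using someI_ex[of "\<lambda>g. g \<in> cont_affine K \<and> approx F k M g"] that by (auto simp: Q_def)
  have D_affine: "D \<subseteq> cont_affine K"
  proof
    fix g assume "g \<in> D"
    then show "g \<in> cont_affine K"
      unfolding D_def
    proof induction
      case (base g)
      then show ?case using pick by auto
    next
      case (step g h)
      then show ?case
        using cont_affine_lincomb[of g K h "1 / 2" "1 / 2"] by (simp add: add_divide_distrib)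
    qed
  qed
  moreover have "\<exists>g\<in>D. \<forall>x\<in>K. \<bar>g x - f x\<bar> < e" if f: "f \<in> cont_affine K" and "e > 0" for f e
  proof -
    \<comment> \<open>Comparing \<open>g\<close> with \<open>f\<close> through a rational
      \<open>q\<close> costs the accuracy twice, hence \<open>e / 2\<close>.\<close>
    obtain k where k: "inverse (real (Suc k)) < e / 2"
      using reals_Archimedean[of "e / 2"] \<open>e > 0\<close> by auto
    define d where "d = inverse (real (Suc k))"
    have f_cont: "continuous_on K f" using f by (simp add: cont_affine_def)
    have BK: "B \<subseteq> K" using bd by (simp add: is_boundary_def)
    have "B \<noteq> {}" using bd f by (auto simp: is_boundary_def)
    obtain L where L: "\<bar>f x\<bar> \<le> L" if "x \<in> K" for x
      using compact_imp_bounded[OF compact_continuous_image[OF f_cont K(1)]]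
      by (auto simp: bounded_iff)
    obtain M where "L \<le> real M" using real_arch_simple by blast
    have "d > 0" by (simp add: d_def)
    obtain P where P: "P \<subseteq> \<N> \<times> UNIV" "countable P" "B \<subseteq> \<Union> (fst ` P)"
      and P_close: "\<forall>(N, q)\<in>P. \<forall>x\<in>N. \<bar>f x - of_rat q\<bar> < d"
      by (rule countable_cover_of_small_oscillation[OF net continuous_on_subset[OF f_cont BK] \<open>d > 0\<close>])
    have "P \<noteq> {}" using \<open>B \<noteq> {}\<close> P(3) by auto
    \<comment> \<open>These are the first \<open>n + 1\<close> pairs of an enumeration of
      \<open>P\<close>, possibly with repetitions. Index 0 is included, so every \<open>F n\<close>
      is nonempty, as membership in \<open>\<F>\<close> requires.\<close>
    define F where "F n = from_nat_into P ` {..n}" for n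
    have FP: "F n \<subseteq> P" for n
      using from_nat_into[OF \<open>P \<noteq> {}\<close>] by (auto simp: F_def)
    have F\<F>: "F n \<in> \<F>" for n
      unfolding \<F>_def
      by (rule finite_subset_in_op_closure_Un) (use FP P(1) in \<open>auto simp: F_def\<close>)
    have f_approx: "approx (F n) k M f" for n
      unfolding approx_def
    proof (intro conjI ballI)
      show "\<bar>f x\<bar> \<le> real M" if "x \<in> K" for x
        using L[OF that] \<open>L \<le> real M\<close> by linarith
      show "case p of (N, q) \<Rightarrow> \<forall>x\<in>N. \<bar>f x - of_rat q\<bar> < inverse (real (Suc k))" if "p \<in> F n" for p
        using P_close FP[of n] that unfolding d_def by blast
    qed
    define E where "E n = {g \<in> D. approx (F n) k M g}" for n
    have "\<exists>g\<in>E 0. \<forall>x\<in>K. \<bar>g x - f x\<bar> < e"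
    proof (rule boundary_eventually_close_imp_close[OF K bd f])
      \<comment> \<open>\<open>f\<close> itself satisfies the requirements, so the data are solvable
        and their pick belongs to \<open>E n\<close>.\<close>
      show "E n \<noteq> {}" for n
      proof -
        have Q: "(F n, k, M) \<in> Q" using F\<F> f f_approx by (auto simp: Q_def)
        then have "pick (F n, k, M) \<in> D" unfolding D_def by (intro op_closure.base imageI)
        then show ?thesis using pick[OF Q] by (auto simp: E_def)
      qed
      show "E (Suc n) \<subseteq> E n" for n
      proof -
        have "F n \<subseteq> F (Suc n)" unfolding F_def by (intro image_mono) auto
        then show ?thesis unfolding E_def approx_def by blast
      qed
      show "E 0 \<subseteq> cont_affine K" using D_affine by (auto simp: E_def)
      show "\<bar>g x\<bar> \<le> real M" if "g \<in> E 0" "x \<in> K" for g x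
        using that by (auto simp: E_def approx_def)
      show "(\<lambda>x. (g x + h x) / 2) \<in> E n" if "g \<in> E n" "h \<in> E n" for n g h
      proof -
        have avg: "\<bar>(a + b) / 2 - c\<bar> < d" if "\<bar>a - c\<bar> < d" "\<bar>b - c\<bar> < d" for a b c d :: real
          using that by (simp add: abs_less_iff field_simps)
        have avg0: "\<bar>(a + b) / 2\<bar> \<le> d" if "\<bar>a\<bar> \<le> d" "\<bar>b\<bar> \<le> d" for a b d :: real
          using that by (simp add: abs_le_iff field_simps)
        have "(\<lambda>x. (g x + h x) / 2) \<in> D"
          using that unfolding E_def D_def by (auto intro: op_closure.step)
        moreover have "approx (F n) k M (\<lambda>x. (g x + h x) / 2)"
          unfolding approx_def
        proof (safe)
          show "\<bar>(g x + h x) / 2\<bar> \<le> real M" if "x \<in> K" for x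
            using \<open>g \<in> E n\<close> \<open>h \<in> E n\<close> that by (intro avg0) (auto simp: E_def approx_def)
          show "\<bar>(g x + h x) / 2 - of_rat q\<bar> < inverse (real (Suc k))"
            if "(N, q) \<in> F n" "x \<in> N" for N q x
            using \<open>g \<in> E n\<close> \<open>h \<in> E n\<close> that by (intro avg) (auto simp: E_def approx_def)
        qed
        ultimately show ?thesis by (simp add: E_def)
      qed
      \<comment> \<open>Take \<open>n\<close> to be the index at which a pair whose set contains
        \<open>b\<close> is enumerated: there both \<open>g b\<close> and \<open>f b\<close> are
        within \<open>d\<close> of the same rational.\<close>
      show "\<exists>n. \<forall>g\<in>E n. \<bar>g b - f b\<bar> \<le> 2 * d" if "b \<in> B" for b
      proof -
        have "b \<in> \<Union> (fst ` P)" using P(3) \<open>b \<in> B\<close> by blast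
        then obtain N q where Nq: "(N, q) \<in> P" "b \<in> N" by auto
        obtain n where "from_nat_into P n = (N, q)"
          using from_nat_into_surj[OF P(2) Nq(1)] by blast
        then have Fn: "(N, q) \<in> F n" unfolding F_def by (metis atMost_iff image_eqI order_refl)
        have "\<bar>g b - f b\<bar> \<le> 2 * d" if "g \<in> E n" for g
        proof -
          have "\<bar>g b - of_rat q\<bar> < d"
            using that Fn Nq(2) by (auto simp: E_def approx_def d_def)
          moreover have "\<bar>f b - of_rat q\<bar> < d" using P_close Nq by blast
          ultimately show ?thesis by linarith
        qed
        then show ?thesis by blast
      qed
      show "2 * d < e" using k by (simp add: d_def)
    qed
    then show ?thesis by (auto simp: E_def)
  qed
  ultimately show ?thesis using D_card by blast
qed

section \<open>The weight of a convex compactum\<close>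

text \<open>Given \<open>x\<close> in an open \<open>U\<close>, the rest of \<open>K\<close> is
  covered by sets where some \<open>g\<close> lies below a rational that is less than
  \<open>g x\<close>. By compactness finitely many suffice, and the matching superlevel sets
  intersect to a neighbourhood of \<open>x\<close> inside \<open>U\<close>. Separation of ordered
  pairs allows superlevel sets alone.\<close>

lemma base_of_separating_functions:
  fixes K :: "'a::topological_space set" and D :: "('a \<Rightarrow> real) set"
  assumes K: "compact K" and D: "\<And>g. g \<in> D \<Longrightarrow> continuous_on K g"
    and sep: "\<And>x y. x \<in> K \<Longrightarrow> y \<in> K \<Longrightarrow> x \<noteq> y \<Longrightarrow> \<exists>g\<in>D. g y < g x"
  shows "base_of_topology (top_of_set K)
    (op_closure (\<inter>) (insert K ((\<lambda>(g, q). {x \<in> K. of_rat q < g x}) ` (D \<times> UNIV))))"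
    (is "base_of_topology _ (op_closure _ ?\<A>)")
  unfolding base_of_topology_def
proof (intro conjI ballI allI impI)
  have above: "openin (top_of_set K) {x \<in> K. c < g x}" if "g \<in> D" for c g
    using continuous_openin_preimage_gen[OF D[OF that] open_greaterThan[of c]]
    by (simp add: vimage_def Int_def)
  fix V assume "V \<in> op_closure (\<inter>) ?\<A>"
  then show "openin (top_of_set K) V"
    by induction (use above in auto)
next
  have below: "openin (top_of_set K) {x \<in> K. g x < c}" if "g \<in> D" for c g
    using continuous_openin_preimage_gen[OF D[OF that] open_lessThan[of c]]
    by (simp add: vimage_def Int_def)
  fix U assume U: "openin (top_of_set K) U"
  have "\<exists>V\<in>op_closure (\<inter>) ?\<A>. x \<in> V \<and> V \<subseteq> U" if "x \<in> U" for x
  proof -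
    have "x \<in> K" using U that openin_subset by fastforce
    define P where "P = {(g, q). g \<in> D \<and> of_rat q < g x}"
    define W where "W = (\<lambda>(g, q). {z \<in> K. g z < real_of_rat q})"
    define A where "A = (\<lambda>(g, q). {z \<in> K. real_of_rat q < g z})"
    have "K \<subseteq> \<Union> (insert U (W ` P))"
    proof
      fix y assume "y \<in> K"
      show "y \<in> \<Union> (insert U (W ` P))"
      proof (cases "y = x")
        case False
        then obtain g where g: "g \<in> D" "g y < g x" using sep[OF \<open>x \<in> K\<close> \<open>y \<in> K\<close>] by auto
        then obtain q where "g y < of_rat q" "of_rat q < g x" using of_rat_dense by blast
        then have "(g, q) \<in> P" "y \<in> W (g, q)" using g \<open>y \<in> K\<close> by (auto simp: P_def W_def)
        then show ?thesis by blast
      qed (use \<open>x \<in> U\<close> in simp)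
    qed
    moreover have "\<forall>c\<in>insert U (W ` P). openin (top_of_set K) c"
      using U below by (auto simp: P_def W_def)
    ultimately have "\<exists>\<D>\<subseteq>insert U (W ` P). finite \<D> \<and> K \<subseteq> \<Union>\<D>"
      by (intro K[unfolded compact_eq_openin_cover, THEN spec, THEN mp] conjI)
    then obtain \<D> where \<D>: "\<D> \<subseteq> insert U (W ` P)" "finite \<D>" "K \<subseteq> \<Union>\<D>"
      by (elim exE conjE)
    have "\<D> - {U} \<subseteq> W ` P" "finite (\<D> - {U})" using \<D>(1,2) by auto
    then obtain P' where P': "P' \<subseteq> P" "finite P'" "\<D> - {U} = W ` P'"
      using finite_subset_image[of "\<D> - {U}" W P] by blast
    \<comment> \<open>\<open>K\<close> plays the role of the empty intersection, which occurs when
      \<open>U\<close> already covers \<open>K\<close>.\<close>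
    have "\<Inter> (insert K (A ` P')) \<in> op_closure (\<inter>) ?\<A>"
    proof (rule Inter_in_op_closure_Int)
      have "A ` P' \<subseteq> A ` (D \<times> UNIV)"
        using P'(1) by (intro image_mono) (auto simp: P_def)
      then show "insert K (A ` P') \<subseteq> ?\<A>"
        unfolding A_def by blast
    qed (use P'(2) in auto)
    moreover have "x \<in> \<Inter> (insert K (A ` P'))"
      using P'(1) \<open>x \<in> K\<close> by (auto simp: A_def P_def)
    moreover have "\<Inter> (insert K (A ` P')) \<subseteq> U"
    proof
      fix z assume z: "z \<in> \<Inter> (insert K (A ` P'))"
      show "z \<in> U"
      proof (rule ccontr)
        assume "z \<notin> U"
        then have "z \<in> \<Union> (\<D> - {U})" using z \<D>(3) by blast
        then obtain g q where "(g, q) \<in> P'" "z \<in> W (g, q)" unfolding P'(3) by auto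
        moreover from this have "z \<in> A (g, q)" using z by blast
        ultimately show False by (auto simp: A_def W_def)
      qed
    qed
    ultimately show ?thesis by blast
  qed
  then show "\<exists>\<M>\<subseteq>op_closure (\<inter>) ?\<A>. \<Union>\<M> = U"
    by (intro exI[of _ "{V \<in> op_closure (\<inter>) ?\<A>. V \<subseteq> U}"]) blast
qed

text \<open>Existential form of \<open>min_card_plus_omega\<close>, from which a minimal family can
  be obtained directly.\<close>

lemma min_card_plus_omega_attained:
  assumes "P \<A>"
  shows "\<exists>\<N>. P \<N> \<and> (\<forall>\<N>'. P \<N>' \<longrightarrow> |\<N>| \<le>o |\<N>'| )
    \<and> min_card_plus_omega P = |\<N>| +c natLeq"
proof (rule min_card_plus_omega[where P = P, OF assms])
  fix \<N>
  assume "P \<N>" "\<And>\<N>'. P \<N>' \<Longrightarrow> |\<N>| \<le>o |\<N>'|"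
    "min_card_plus_omega P = |\<N>| +c natLeq"
  then show ?thesis by (intro exI[of _ \<N>] conjI allI impI)
qed

theorem mainTheorem3:
  fixes K B :: "'a::locally_convex_t2_space set"
  assumes "compact K" and "convex K"
    and "is_boundary K B"
  shows "weight (top_of_set K) \<le>o nw_cz (top_of_set B)"
proof -
  obtain \<N> where net: "cz_network (top_of_set B) \<N>" and nw: "nw_cz (top_of_set B) = |\<N>| +c natLeq"
    using min_card_plus_omega_attained[of "cz_network (top_of_set B)", OF cz_network_Pow]
    unfolding nw_cz_def by (elim exE conjE)
  \<comment> \<open>Every family is counted against this cardinal; adding \<open>natLeq\<close>
    makes it infinite even for a finite network, so countable factors are absorbed.\<close>
  define r where "r = |\<N>| +c natLeq"
  have r: "Cinfinite r" "|\<N>| \<le>o r" "natLeq \<le>o r"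
    unfolding r_def
    by (simp_all add: Cinfinite_csum natLeq_Cinfinite ordLeq_csum1 ordLeq_csum2 card_of_Card_order
        natLeq_Card_order)
  obtain D where D: "D \<subseteq> cont_affine K" "|D| \<le>o r"
    and dense: "\<And>f e. f \<in> cont_affine K \<Longrightarrow> e > 0 \<Longrightarrow> \<exists>g\<in>D. \<forall>x\<in>K. \<bar>g x - f x\<bar> < e"
    using dense_affine_functions[OF assms net r(1,2)] by blast
  define \<A> where "\<A> = insert K ((\<lambda>(g, q). {x \<in> K. of_rat q < g x}) ` (D \<times> UNIV))"
  have base: "base_of_topology (top_of_set K) (op_closure (\<inter>) \<A>)"
    unfolding \<A>_def
  proof (rule base_of_separating_functions[OF assms(1)])
    show "continuous_on K g" if "g \<in> D" for g
      using that D(1) by (auto simp: cont_affine_def)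
    fix x y assume xy: "x \<in> K" "y \<in> K" "x \<noteq> y"
    obtain f where f: "linear f" "continuous_on UNIV f" "f y < (f x :: real)"
      by (rule separating_functional[OF xy(3)])
    \<comment> \<open>Half the gap: approximation within \<open>d\<close> at both points cannot
      reverse or close it.\<close>
    define d where "d = (f x - f y) / 2"
    have d: "d > 0" "2 * d = f x - f y" using f(3) by (simp_all add: d_def)
    obtain g where "g \<in> D" "\<forall>z\<in>K. \<bar>g z - f z\<bar> < d"
      using dense linear_in_cont_affine[OF f(1,2)] d(1) by blast
    moreover from this have "\<bar>g x - f x\<bar> < d" "\<bar>g y - f y\<bar> < d"
      using xy by auto
    then have "g y < g x" using d(2) by linarith
    ultimately show "\<exists>g\<in>D. g y < g x" by blast
  qed
  have "|(\<lambda>(g, q). {x \<in> K. of_rat q < g x}) ` (D \<times> UNIV)| \<le>o r"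
    by (intro card_of_image_ordLeq
        Times_Cinfinite_bound[OF r(1) D(2) countable_ordLeq_Cinfinite[OF r(1)]]) simp
  then have "|{K} \<union> (\<lambda>(g, q). {x \<in> K. of_rat q < g x}) ` (D \<times> UNIV)| \<le>o r"
    by (intro Un_Cinfinite_bound[OF countable_ordLeq_Cinfinite[OF r(1)] _ r(1)]) simp
  then have "|\<A>| \<le>o r"
    by (simp add: \<A>_def)
  then have small: "|op_closure (\<inter>) \<A>| \<le>o r"
    by (rule card_of_op_closure[OF r(1)])
  obtain \<B> where min: "\<forall>\<B>'. base_of_topology (top_of_set K) \<B>' \<longrightarrow> |\<B>| \<le>o |\<B>'|"
    and w: "weight (top_of_set K) = |\<B>| +c natLeq"
    using min_card_plus_omega_attained[of "base_of_topology (top_of_set K)",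
        OF base_of_topology_openin]
    unfolding weight_def by (elim exE conjE)
  \<comment> \<open>The minimal base is no larger than the one built from \<open>D\<close>; the
    summand \<open>natLeq\<close> of the weight is absorbed because \<open>r\<close> is
    infinite.\<close>
  have "|\<B>| \<le>o r"
    by (rule ordLeq_transitive[OF min[rule_format, OF base] small])
  then show ?thesis
    unfolding w nw r_def[symmetric]
    by (rule csum_cinfinite_bound[OF _ r(3) card_of_Card_order natLeq_Card_order r(1)])
qed

end
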